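(* Let $\mathcal{G}=(V,V_d,E)$ be a damping graph. If $\mathcal{G}$ satisfies the zero forcing property, then $\mathcal{G}$ is PI-GAS.
   Context: Damping graph. A damping graph $\mathcal{G}=(V,V_d,E)$ is a finite simple connected undirected graph $(V,E)$ together with a nonempty set $V_d\subseteq V$ of damped nodes; $n=|V|$, $m=|E|$. PI-GAS. Fix an integer $r\ge1$, let $B\in\mathbb{R}^{n\times m}$ be an oriented incidence matrix of $(V,E)$ (each column has one $1$ and one $-1$, at the endpoints of the edge) and $\mathbb{B}=B\otimes I_r$. Feasible parameters are block diagonal matrices with $r\times r$ blocks $M=\mathrm{diag}(M_1,\dots,M_n)$, $W=\mathrm{diag}(W_1,\dots,W_m)$, $R=\mathrm{diag}(R_1,\dots,R_n)$, where all $M_i$ and $W_k$ are diagonal and positive definite, $R_i$ is symmetric positive definite for $i\in V_d$, and $R_i$ is symmetric positive semidefinite and singular (possibly zero) for $i\notin V_d$. Consider the linear system $$\dot p=-RM^{-1}p-\mathbb{B}Wq,\qquad \dot q=\mathbb{B}^TM^{-1}p$$ on the invariant subspace $\Omega=\{(p,q)\in\mathbb{R}^{rn}\times\mathbb{R}^{rm}: q\in\operatorname{im}(\mathbb{B}^T)\}$. $\mathcal{G}$ is parameter-independent globally asymptotically stable (PI-GAS) if for all feasible parameters $M,W,R$ the origin of this system on $\Omega$ is globally asymptotically stable. Zero forcing. Start with the damped nodes black and all other nodes white. Repeatedly apply the rule: if a black node has exactly one white neighbor $w$, recolor $w$ black; stop when the rule no longer applies. $\mathcal{D}(\mathcal{G})$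 denotes the final set of black nodes. $\mathcal{G}$ satisfies the zero forcing property if $\mathcal{D}(\mathcal{G})=V$. *)

theory Defs
  imports "HOL-Analysis.Analysis"
begin

section \<open>Damping graphs\<close>

text \<open>The node set \<open>V\<close> is the whole finite type \<open>'v\<close>; an undirected edge is a set of
  exactly two nodes.\<close>

definition damping_graph :: "'v::finite set \<Rightarrow> 'v set set \<Rightarrow> bool" where
  "damping_graph Vd E \<longleftrightarrow>
     Vd \<noteq> {} \<and> (\<forall>e\<in>E. card e = 2) \<and> (\<forall>u v. (u, v) \<in> {(x, y). {x, y} \<in> E}\<^sup>*)"

section \<open>Zero forcing\<close>

text \<open>\<open>S\<close> is the current set of black nodes; \<open>u\<close> is a black node whose only white
  neighbor is \<open>w\<close>.\<close>

definition force_step :: "'v set set \<Rightarrow> 'v set \<Rightarrow> 'v set \<Rightarrow> bool" where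
  "force_step E S S' \<longleftrightarrow>
     (\<exists>u\<in>S. \<exists>w. {x. {u, x} \<in> E \<and> x \<notin> S} = {w} \<and> S' = insert w S)"

definition terminal_black_set :: "'v set \<Rightarrow> 'v set set \<Rightarrow> 'v set \<Rightarrow> bool" where
  "terminal_black_set Vd E D \<longleftrightarrow> (force_step E)\<^sup>*\<^sup>* Vd D \<and> \<not> (\<exists>S'. force_step E D S')"

text \<open>The process terminates, and its outcome does not depend on the order of the
  recolorings.\<close>

lemma force_step_reach_subset:
  assumes "(force_step E)\<^sup>*\<^sup>* Vd S" "Vd \<subseteq> T" "\<not> (\<exists>S'. force_step E T S')"
  shows "S \<subseteq> T"
  using assms(1)
proof (induction rule: rtranclp_induct)
  case base
  show ?case by (fact assms(2))
next
  case (step S S')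
  from step.hyps(2) obtain u w
    where u: "u \<in> S" and w: "{x. {u, x} \<in> E \<and> x \<notin> S} = {w}" and S': "S' = insert w S"
    unfolding force_step_def by blast
  have "w \<in> T"
  proof (rule ccontr)
    assume "w \<notin> T"
    then have "{x. {u, x} \<in> E \<and> x \<notin> T} = {w}" using w step.IH by blast
    then have "force_step E T (insert w T)" using u step.IH unfolding force_step_def by blast
    then show False using assms(3) by blast
  qed
  then show ?case using S' step.IH by blast
qed

lemma force_step_psubset: "force_step E S S' \<Longrightarrow> S \<subset> S'"
  unfolding force_step_def by blast

lemma force_step_reach_mono: "(force_step E)\<^sup>*\<^sup>* S S' \<Longrightarrow> S \<subseteq> S'"
  by (induction rule: rtranclp_induct) (use force_step_psubset in blast)+

lemma ex1_terminal_black_set: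
  fixes Vd :: "'v::finite set"
  shows "\<exists>!D. terminal_black_set Vd E D"
proof (rule ex_ex1I)
  have "\<exists>D. (force_step E)\<^sup>*\<^sup>* S D \<and> \<not> (\<exists>S'. force_step E D S')" for S :: "'v set"
  proof (induction "card (- S)" arbitrary: S rule: less_induct)
    case less
    show ?case
    proof (cases "\<exists>S'. force_step E S S'")
      case True
      then obtain S' where S': "force_step E S S'" by blast
      then have "card (- S') < card (- S)"
        by (intro psubset_card_mono) (use force_step_psubset in auto)
      from less[OF this] show ?thesis
        using S' by (meson converse_rtranclp_into_rtranclp)
    qed blast
  qed
  then show "\<exists>D. terminal_black_set Vd E D" unfolding terminal_black_set_def .
next
  fix D D' assume "terminal_black_set Vd E D" "terminal_black_set Vd E D'"
  then show "D = D'"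
    unfolding terminal_black_set_def
    by (meson force_step_reach_subset force_step_reach_mono subset_antisym)
qed

definition final_black_set :: "'v set \<Rightarrow> 'v set set \<Rightarrow> 'v set" where
  "final_black_set Vd E = (THE D. terminal_black_set Vd E D)"

definition zero_forcing_property :: "'v::finite set \<Rightarrow> 'v set set \<Rightarrow> bool" where
  "zero_forcing_property Vd E \<longleftrightarrow> final_black_set Vd E = UNIV"

section \<open>Global asymptotic stability\<close>

definition solves_ode :: "('a::real_normed_vector \<Rightarrow> 'a) \<Rightarrow> (real \<Rightarrow> 'a) \<Rightarrow> bool" where
  "solves_ode f x \<longleftrightarrow> (\<forall>t\<ge>0. (x has_vector_derivative f (x t)) (at t within {0..}))"

definition origin_GAS_on :: "'a set \<Rightarrow> ('a::real_normed_vector \<Rightarrow> 'a) \<Rightarrow> bool" where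
  "origin_GAS_on \<Omega> f \<longleftrightarrow>
     (\<forall>\<epsilon>>0. \<exists>\<delta>>0. \<forall>x. solves_ode f x \<and> x 0 \<in> \<Omega> \<and> norm (x 0) < \<delta> \<longrightarrow>
        (\<forall>t\<ge>0. norm (x t) < \<epsilon>)) \<and>
     (\<forall>x. solves_ode f x \<and> x 0 \<in> \<Omega> \<longrightarrow> (x \<longlongrightarrow> 0) at_top)"

section \<open>The parametrized linear system\<close>

definition diagonal_matrix :: "real^'n^'n \<Rightarrow> bool" where
  "diagonal_matrix A \<longleftrightarrow> (\<forall>i j. i \<noteq> j \<longrightarrow> A $ i $ j = 0)"

definition pos_definite :: "real^'n^'n \<Rightarrow> bool" where
  "pos_definite A \<longleftrightarrow> transpose A = A \<and> (\<forall>x. x \<noteq> 0 \<longrightarrow> 0 < x \<bullet> (A *v x))"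

definition pos_semidefinite :: "real^'n^'n \<Rightarrow> bool" where
  "pos_semidefinite A \<longleftrightarrow> transpose A = A \<and> (\<forall>x. 0 \<le> x \<bullet> (A *v x))"

definition block_diag :: "('i::finite \<Rightarrow> real^'r::finite^'r) \<Rightarrow> real^('i \<times> 'r)^('i \<times> 'r)" where
  "block_diag A = (\<chi> a b. if fst a = fst b then A (fst a) $ snd a $ snd b else 0)"

definition kronecker_id :: "real^'e::finite^'v::finite \<Rightarrow> real^('e \<times> 'r::finite)^('v \<times> 'r)" where
  "kronecker_id B = (\<chi> a b. B $ fst a $ fst b * mat 1 $ snd a $ snd b)"

text \<open>Columns are indexed by all sets of nodes, the ones outside \<open>E\<close> being zero. (A type of
  edges would exclude the one-node graph, since types are nonempty.) The image of the transpose
  then consists of vectors vanishing outside \<open>E\<close>, so that \<open>state_subspace\<close> below has no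
  components besides those indexed by nodes and by edges in \<open>E\<close>.\<close>

definition oriented_incidence_matrix :: "'v set set \<Rightarrow> real^('v::finite set)^'v \<Rightarrow> bool" where
  "oriented_incidence_matrix E B \<longleftrightarrow>
     (\<forall>e\<in>E. \<exists>u v. u \<noteq> v \<and> e = {u, v} \<and> B $ u $ e = 1 \<and> B $ v $ e = -1 \<and>
        (\<forall>w. w \<notin> e \<longrightarrow> B $ w $ e = 0)) \<and>
     (\<forall>e. e \<notin> E \<longrightarrow> (\<forall>w. B $ w $ e = 0))"

text \<open>Blocks \<open>W e\<close> with \<open>e \<notin> E\<close> are unconstrained: they only meet zero columns of the incidence
  matrix.\<close>

definition feasible ::
  "'v::finite set \<Rightarrow> 'v set set \<Rightarrow> ('v \<Rightarrow> real^'r::finite^'r) \<Rightarrow> ('v set \<Rightarrow> real^'r^'r) \<Rightarrow>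
     ('v \<Rightarrow> real^'r^'r) \<Rightarrow> bool" where
  "feasible Vd E M W R \<longleftrightarrow>
     (\<forall>i. diagonal_matrix (M i) \<and> pos_definite (M i)) \<and>
     (\<forall>e\<in>E. diagonal_matrix (W e) \<and> pos_definite (W e)) \<and>
     (\<forall>i\<in>Vd. pos_definite (R i)) \<and>
     (\<forall>i. i \<notin> Vd \<longrightarrow> pos_semidefinite (R i) \<and> \<not> invertible (R i))"

definition system_field ::
  "real^('v::finite set)^'v \<Rightarrow> ('v \<Rightarrow> real^'r::finite^'r) \<Rightarrow> ('v set \<Rightarrow> real^'r^'r) \<Rightarrow>
     ('v \<Rightarrow> real^'r^'r) \<Rightarrow>
     (real^('v \<times> 'r)) \<times> (real^('v set \<times> 'r)) \<Rightarrow> (real^('v \<times> 'r)) \<times> (real^('v set \<times> 'r))" where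
  "system_field B M W R = (\<lambda>(p, q).
     (- ((block_diag R ** matrix_inv (block_diag M)) *v p) - (kronecker_id B ** block_diag W) *v q,
      (transpose (kronecker_id B) ** matrix_inv (block_diag M)) *v p))"

definition state_subspace ::
  "real^('v::finite set)^'v \<Rightarrow> ((real^('v \<times> 'r::finite)) \<times> (real^('v set \<times> 'r))) set" where
  "state_subspace B = UNIV \<times> range (\<lambda>z. transpose (kronecker_id B) *v z)"

text \<open>The type argument provides \<open>r = CARD('r)\<close>.\<close>

definition PI_GAS :: "'r::finite itself \<Rightarrow> 'v::finite set \<Rightarrow> 'v set set \<Rightarrow> bool" where
  "PI_GAS (r :: 'r itself) Vd E \<longleftrightarrow>
     (\<forall>B. oriented_incidence_matrix E B \<longrightarrow>
       (\<forall>(M :: 'v \<Rightarrow> real^'r^'r) (W :: 'v set \<Rightarrow> real^'r^'r) (R :: 'v \<Rightarrow> real^'r^'r).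
          feasible Vd E M W R \<longrightarrow> origin_GAS_on (state_subspace B) (system_field B M W R)))"

end

(* The energy (p . M^-1 p + q . W q) / 2 is nonincreasing, so solutions are bounded, together with
   all their derivatives. Hence, by Barbalat's lemma, if a linear function of the state converges,
   then its derivative tends to 0. Applied to the energy, the lemma gives y . R y -> 0 for the
   velocity y = M^-1 p, so the velocities of the damped nodes vanish asymptotically. If the
   velocity of a node u vanishes, then so do its derivative and therefore the u-component of B W q;
   differentiating once more, so does the u-component of B W B^T y, which is a combination
   of the velocity differences along the edges at u. If all neighbors of u but w are already known
   to have vanishing velocity, then that of w vanishes too: this is a step of the zero forcing
   process. Once y -> 0, also p -> 0 and B W q -> 0, and B W is injective on the image of B^T. *)

theory Submission
  imports Defs
begin

section \<open>Barbalat's lemma, monotone convergence, quadratic forms\<close>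

text \<open>Barbalat's lemma. The bound on \<open>f''\<close> makes \<open>f'\<close> Lipschitz, so
  a large value of \<open>f'\<close> at \<open>t\<close> persists on a window of fixed length
  \<open>h\<close> and forces \<open>f\<close> to move by a definite amount there, which convergence
  of \<open>f\<close> rules out for late \<open>t\<close>.\<close>

lemma tendsto_zero_derivative_of_convergent:
  fixes f f' f'' :: "real \<Rightarrow> 'a::real_normed_vector"
  assumes lim: "(f \<longlongrightarrow> l) at_top"
    and f': "\<And>t. t \<ge> 0 \<Longrightarrow> (f has_vector_derivative f' t) (at t within {0..})"
    and f'': "\<And>t. t \<ge> 0 \<Longrightarrow> (f' has_vector_derivative f'' t) (at t within {0..})"
    and bound: "\<And>t. t \<ge> 0 \<Longrightarrow> norm (f'' t) \<le> K"
  shows "(f' \<longlongrightarrow> 0) at_top"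
proof (rule tendstoI)
  fix e :: real assume "e > 0"
  have "K \<ge> 0" using bound[of 0] norm_ge_zero[of "f'' 0"] by linarith
  \<comment> \<open>The window is so short that \<open>f'\<close> varies by less than
    \<open>e / 2\<close> on it; \<open>K + 1\<close> in place of \<open>K\<close> avoids division by
    zero.\<close>
  define h where "h = e / (2 * (K + 1))"
  have "h > 0" using \<open>e > 0\<close> \<open>K \<ge> 0\<close> by (simp add: h_def)
  have hK: "h * K < e / 2"
  proof -
    have "h * K < h * (K + 1)" using \<open>h > 0\<close> by simp
    also have "\<dots> = e / 2" using \<open>K \<ge> 0\<close> by (simp add: h_def field_simps)
    finally show ?thesis .
  qed
  have "\<forall>\<^sub>F t in at_top. dist (f t) l < h * e / 4"
    using lim \<open>h > 0\<close> \<open>e > 0\<close> by (intro tendstoD) auto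
  then obtain T where T: "\<And>t. t \<ge> T \<Longrightarrow> dist (f t) l < h * e / 4"
    by (auto simp: eventually_at_top_linorder)
  have "dist (f' t) 0 < e" if t: "t \<ge> max T 0" for t
  proof -
    have seg: "closed_segment t (t + h) = {t..t + h}"
      using \<open>h > 0\<close> by (simp add: closed_segment_eq_real_ivl)
    have lip: "norm (f' s - f' t) \<le> h * K" if "s \<in> {t..t + h}" for s
    proof -
      have "norm (f' s - f' t) \<le> K * norm (s - t)"
      proof (rule differentiable_bound[of "{t..t + h}" f' "\<lambda>u d. d *\<^sub>R f'' u"])
        show "(f' has_derivative (\<lambda>d. d *\<^sub>R f'' u)) (at u within {t..t + h})"
          if "u \<in> {t..t + h}" for u
          using that t has_vector_derivative_within_subset[OF f'', of u "{t..t + h}"]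
          by (auto simp: has_vector_derivative_def)
        show "onorm (\<lambda>d. d *\<^sub>R f'' u) \<le> K" if "u \<in> {t..t + h}" for u
          using that t bound[of u] \<open>K \<ge> 0\<close>
          by (intro onorm_bound) (auto simp: mult.commute[of K] intro: mult_left_mono)
      qed (use that \<open>h > 0\<close> in auto)
      also have "\<dots> \<le> K * h" using that \<open>K \<ge> 0\<close> by (intro mult_left_mono) auto
      finally show ?thesis by (simp add: mult.commute)
    qed
    \<comment> \<open>On the window \<open>f'\<close> stays within \<open>h * K\<close> of
      \<open>f' t\<close>, so replacing \<open>f\<close> by its tangent at \<open>t\<close> costs at
      most \<open>h * (h * K)\<close>.\<close>
    have "norm (f (t + h) - f t - (t + h - t) *\<^sub>R f' t) \<le> norm (t + h - t) * (h * K)"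
      using t \<open>h > 0\<close> lip
      by (intro vector_differentiable_bound_linearization[where S = "{t..t + h}"])
         (auto simp: seg intro!: has_vector_derivative_within_subset[OF f'])
    then have 1: "norm (f (t + h) - f t - h *\<^sub>R f' t) \<le> h * (h * K)"
      using \<open>h > 0\<close> by simp
    have 2: "norm (f (t + h) - f t) < h * e / 2"
      using T[of t] T[of "t + h"] t \<open>h > 0\<close> dist_triangle2[of "f (t + h)" "f t" l]
      by (simp add: dist_norm)
    have "norm (h *\<^sub>R f' t) \<le> norm (f (t + h) - f t) + norm (f (t + h) - f t - h *\<^sub>R f' t)"
      using norm_triangle_sub[of "h *\<^sub>R f' t" "f (t + h) - f t"]
      by (simp only: norm_minus_commute)
    also have "\<dots> < h * e"
    proof -
      have "h * (h * K) < h * e / 2" using mult_strict_left_mono[OF hK \<open>h > 0\<close>] by simp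
      then show ?thesis using 1 2 by linarith
    qed
    finally have "h * norm (f' t) < h * e" using \<open>h > 0\<close> by simp
    then show ?thesis using \<open>h > 0\<close> by simp
  qed
  then show "\<forall>\<^sub>F t in at_top. dist (f' t) 0 < e"
    unfolding eventually_at_top_linorder by blast
qed

lemma nonincreasing_on_nonneg:
  fixes f f' :: "real \<Rightarrow> real"
  assumes f': "\<And>t. t \<ge> 0 \<Longrightarrow> (f has_vector_derivative f' t) (at t within {0..})"
    and nonpos: "\<And>t. t \<ge> 0 \<Longrightarrow> f' t \<le> 0"
    and "0 \<le> s" "s \<le> t"
  shows "f t \<le> f s"
proof -
  have "\<exists>u\<in>{s..t}. f t - f s = (t - s) *\<^sub>R f' u"
    using assms(3,4)
    by (intro mvt_very_simple has_vector_derivative_within_subset[OF f', unfolded has_vector_derivative_def]) auto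
  then show ?thesis using nonpos assms(3,4)
    by (smt (verit) atLeastAtMost_iff mult_nonneg_nonpos real_scaleR_def)
qed

lemma convergent_nonincreasing_on_nonneg:
  fixes f :: "real \<Rightarrow> real"
  assumes mono: "\<And>s t. 0 \<le> s \<Longrightarrow> s \<le> t \<Longrightarrow> f t \<le> f s"
    and lower: "\<And>t. t \<ge> 0 \<Longrightarrow> b \<le> f t"
  obtains l where "(f \<longlongrightarrow> l) at_top"
proof
  have bdd: "bdd_below (f ` {0..})" using lower by (auto intro: bdd_belowI[of _ b])
  show "(f \<longlongrightarrow> Inf (f ` {0..})) at_top"
  proof (rule decreasing_tendsto)
    show "\<forall>\<^sub>F t in at_top. Inf (f ` {0..}) \<le> f t"
      using eventually_ge_at_top[of 0] by eventually_elim (auto intro: cInf_lower bdd)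
    fix c assume "Inf (f ` {0..}) < c"
    then obtain s where s: "s \<ge> 0" "f s < c"
      using cInf_less_iff[OF _ bdd] by auto
    show "\<forall>\<^sub>F t in at_top. f t < c"
      using eventually_ge_at_top[of s] by eventually_elim (use mono s in force)
  qed
qed

text \<open>The constant is the minimum of the form on the unit sphere, attained by compactness and
  positive since the minimizer is nonzero. Homogeneity of degree two extends the bound to all
  vectors.\<close>

lemma positive_quadratic_form_lower_bound:
  fixes P :: "'a::euclidean_space \<Rightarrow> 'a"
  assumes P: "linear P" and pos: "\<And>x. x \<noteq> 0 \<Longrightarrow> 0 < x \<bullet> P x"
  obtains c where "c > 0" "\<And>x. c * (norm x)\<^sup>2 \<le> x \<bullet> P x"
proof -
  have "continuous_on (sphere 0 1) (\<lambda>x. x \<bullet> P x)"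
    using P by (intro continuous_intros linear_continuous_on) (simp add: linear_conv_bounded_linear)
  moreover have "sphere (0::'a) 1 \<noteq> {}" by simp
  ultimately have "\<exists>u\<in>sphere 0 1. \<forall>x\<in>sphere 0 1. u \<bullet> P u \<le> x \<bullet> P x"
    by (intro continuous_attains_inf compact_sphere)
  then obtain u where u: "u \<in> sphere 0 1" "\<And>x. x \<in> sphere 0 1 \<Longrightarrow> u \<bullet> P u \<le> x \<bullet> P x"
    by blast
  have "(u \<bullet> P u) * (norm x)\<^sup>2 \<le> x \<bullet> P x" for x
  proof (cases "x = 0")
    case False
    have "u \<bullet> P u \<le> (x /\<^sub>R norm x) \<bullet> P (x /\<^sub>R norm x)"
      using False by (intro u) simp
    also have "\<dots> = (x \<bullet> P x) / (norm x)\<^sup>2"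
      by (simp add: linear_scale[OF P] power2_eq_square divide_simps)
    finally show ?thesis using False by (simp add: field_simps)
  qed (simp add: linear_0[OF P])
  moreover have "u \<noteq> 0" using u(1) by auto
  then have "u \<bullet> P u > 0" by (rule pos)
  ultimately show ?thesis using that by blast
qed

section \<open>Linear systems with a nonincreasing quadratic energy\<close>

text \<open>Abstract setting for the energy argument: \<open>P x\<close> is the gradient of the
  energy \<open>(x \<bullet> P x) / 2\<close>, and \<open>A x \<bullet> P x\<close> is the rate of
  change of this energy along solutions.\<close>

locale dissipative_system =
  fixes A P :: "'a::euclidean_space \<Rightarrow> 'a"
  assumes linear_A: "linear A" and linear_P: "linear P"
    and self_adjoint: "P x \<bullet> y = x \<bullet> P y"
    and positive: "x \<noteq> 0 \<Longrightarrow> 0 < x \<bullet> P x"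
    and dissipative: "A x \<bullet> P x \<le> 0"
begin

lemma bounded_linear_A: "bounded_linear A" and bounded_linear_P: "bounded_linear P"
  using linear_A linear_P by (simp_all add: linear_conv_bounded_linear)

lemma has_vector_derivative_linear_along:
  assumes "solves_ode A x" "bounded_linear L" "t \<ge> 0"
  shows "((\<lambda>t. L (x t)) has_vector_derivative L (A (x t))) (at t within {0..})"
  using assms unfolding solves_ode_def by (auto intro: bounded_linear.has_vector_derivative)

lemma has_vector_derivative_energy:
  assumes "solves_ode A x" "t \<ge> 0"
  shows "((\<lambda>t. x t \<bullet> P (x t)) has_vector_derivative 2 * (A (x t) \<bullet> P (x t))) (at t within {0..})"
proof -
  have "((\<lambda>t. x t \<bullet> P (x t)) has_vector_derivative x t \<bullet> P (A (x t)) + A (x t) \<bullet> P (x t))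
      (at t within {0..})"
    using has_vector_derivative_linear_along[OF assms(1) bounded_linear_ident assms(2)]
      has_vector_derivative_linear_along[OF assms(1) bounded_linear_P assms(2)]
    by (rule bounded_bilinear.has_vector_derivative[OF bounded_bilinear_inner])
  moreover have "x t \<bullet> P (A (x t)) = A (x t) \<bullet> P (x t)"
    by (metis self_adjoint inner_commute)
  ultimately show ?thesis by simp
qed

lemma energy_antimono:
  assumes "solves_ode A x" "0 \<le> s" "s \<le> t"
  shows "x t \<bullet> P (x t) \<le> x s \<bullet> P (x s)"
  by (rule nonincreasing_on_nonneg[OF has_vector_derivative_energy])
     (use assms dissipative in \<open>auto simp: mult_nonneg_nonpos\<close>)

text \<open>The energy is comparable to the squared norm from both sides and does not grow. The
  constant \<open>C\<close> is the same for all solutions, which is what stability requires.\<close>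

lemma solution_bound:
  obtains C where "C > 0" "\<And>x t. solves_ode A x \<Longrightarrow> t \<ge> 0 \<Longrightarrow> norm (x t) \<le> C * norm (x 0)"
proof -
  obtain c where c: "c > 0" "\<And>x. c * (norm x)\<^sup>2 \<le> x \<bullet> P x"
    using positive_quadratic_form_lower_bound[OF linear_P positive] by blast
  obtain K where K: "K > 0" "\<And>x. norm (P x) \<le> norm x * K"
    using bounded_linear.pos_bounded[OF bounded_linear_P] by blast
  have "norm (x t) \<le> sqrt (K / c) * norm (x 0)" if x: "solves_ode A x" and t: "t \<ge> 0" for x t
  proof (rule power2_le_imp_le)
    have "c * (norm (x t))\<^sup>2 \<le> x t \<bullet> P (x t)" by (rule c)
    also have "\<dots> \<le> x 0 \<bullet> P (x 0)" using x t by (intro energy_antimono) auto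
    also have "\<dots> \<le> norm (x 0) * norm (P (x 0))" by (rule norm_cauchy_schwarz)
    also have "\<dots> \<le> norm (x 0) * (norm (x 0) * K)" by (intro mult_left_mono K) simp
    finally show "(norm (x t))\<^sup>2 \<le> (sqrt (K / c) * norm (x 0))\<^sup>2"
      using c(1) K(1) by (simp add: power_mult_distrib field_simps power2_eq_square)
  qed (use c(1) K(1) in simp)
  moreover have "sqrt (K / c) > 0" using c(1) K(1) by simp
  ultimately show ?thesis using that by blast
qed

lemma linear_along_bounded:
  assumes "solves_ode A x" "bounded_linear L"
  obtains K where "K > 0" "\<And>t. t \<ge> 0 \<Longrightarrow> norm (L (x t)) \<le> K"
proof -
  obtain C where C: "C > 0" "\<And>t. t \<ge> 0 \<Longrightarrow> norm (x t) \<le> C * norm (x 0)"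
    using solution_bound assms(1) by metis
  obtain D where D: "D > 0" "\<And>z. norm (L z) \<le> norm z * D"
    using bounded_linear.pos_bounded[OF assms(2)] by blast
  \<comment> \<open>The summand 1 keeps the bound strictly positive even for a solution starting at
    the origin.\<close>
  have "norm (L (x t)) \<le> C * norm (x 0) * D + 1" if "t \<ge> 0" for t
    using D(2)[of "x t"] mult_right_mono[OF C(2)[OF that], of D] D(1) by linarith
  moreover have "C * norm (x 0) * D + 1 > 0" using C(1) D(1) by (simp add: add_nonneg_pos)
  ultimately show ?thesis using that by blast
qed

text \<open>Barbalat's lemma for a linear observable \<open>L\<close>: its first and second
  derivatives along a solution are \<open>L (A x)\<close> and \<open>L (A (A x))\<close>, and the
  latter is bounded because the solution is.\<close>

lemma tendsto_zero_linear_derivative: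
  assumes x: "solves_ode A x" and L: "bounded_linear L" and "((\<lambda>t. L (x t)) \<longlongrightarrow> l) at_top"
  shows "((\<lambda>t. L (A (x t))) \<longlongrightarrow> 0) at_top"
proof -
  have LA: "bounded_linear (\<lambda>z. L (A z))"
    by (rule bounded_linear_compose[OF L bounded_linear_A])
  have LAA: "bounded_linear (\<lambda>z. L (A (A z)))"
    by (rule bounded_linear_compose[OF LA bounded_linear_A])
  obtain K where "\<And>t. t \<ge> 0 \<Longrightarrow> norm (L (A (A (x t)))) \<le> K"
    using linear_along_bounded[OF x LAA] by blast
  then show ?thesis
    using has_vector_derivative_linear_along[OF x L] has_vector_derivative_linear_along[OF x LA]
    by (intro tendsto_zero_derivative_of_convergent[OF assms(3)])
qed

text \<open>The energy is nonincreasing and nonnegative, hence convergent, so Barbalat's lemma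
  applies to it. Its second derivative is a sum of inner products of bounded linear
  observables.\<close>

lemma tendsto_zero_dissipation:
  assumes x: "solves_ode A x"
  shows "((\<lambda>t. A (x t) \<bullet> P (x t)) \<longlongrightarrow> 0) at_top"
proof -
  have bl: "bounded_linear (\<lambda>z. P (A z))" "bounded_linear (\<lambda>z. A (A z))"
    using bounded_linear_compose bounded_linear_A bounded_linear_P by auto
  have "0 \<le> z \<bullet> P z" for z
    using positive[of z] by (cases "z = 0") auto
  then obtain l where lim: "((\<lambda>t. x t \<bullet> P (x t)) \<longlongrightarrow> l) at_top"
    using convergent_nonincreasing_on_nonneg[of "\<lambda>t. x t \<bullet> P (x t)" 0] energy_antimono[OF x]
    by blast
  define f'' where "f'' t = 2 * (A (x t) \<bullet> P (A (x t)) + A (A (x t)) \<bullet> P (x t))" for t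
  have f'': "((\<lambda>t. 2 * (A (x t) \<bullet> P (x t))) has_vector_derivative f'' t) (at t within {0..})"
    if "t \<ge> 0" for t
    unfolding f''_def
    by (intro bounded_linear.has_vector_derivative[OF bounded_linear_mult_right]
          bounded_bilinear.has_vector_derivative[OF bounded_bilinear_inner]
          has_vector_derivative_linear_along[OF x] bounded_linear_A bounded_linear_P that)
  obtain K1 where K1: "K1 > 0" "\<And>t. t \<ge> 0 \<Longrightarrow> norm (A (x t)) \<le> K1"
    using linear_along_bounded[OF x bounded_linear_A] by blast
  obtain K2 where K2: "K2 > 0" "\<And>t. t \<ge> 0 \<Longrightarrow> norm (P (A (x t))) \<le> K2"
    using linear_along_bounded[OF x bl(1)] by blast
  obtain K3 where K3: "K3 > 0" "\<And>t. t \<ge> 0 \<Longrightarrow> norm (A (A (x t))) \<le> K3"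
    using linear_along_bounded[OF x bl(2)] by blast
  obtain K4 where K4: "K4 > 0" "\<And>t. t \<ge> 0 \<Longrightarrow> norm (P (x t)) \<le> K4"
    using linear_along_bounded[OF x bounded_linear_P] by blast
  have "norm (f'' t) \<le> 2 * (K1 * K2 + K3 * K4)" if t: "t \<ge> 0" for t
  proof -
    have "\<bar>A (x t) \<bullet> P (A (x t))\<bar> \<le> K1 * K2"
      using Cauchy_Schwarz_ineq2 mult_mono'[OF K1(2)[OF t] K2(2)[OF t]] order_trans by fastforce
    moreover have "\<bar>A (A (x t)) \<bullet> P (x t)\<bar> \<le> K3 * K4"
      using Cauchy_Schwarz_ineq2 mult_mono'[OF K3(2)[OF t] K4(2)[OF t]] order_trans by fastforce
    ultimately show ?thesis unfolding f''_def by simp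
  qed
  then have "((\<lambda>t. 2 * (A (x t) \<bullet> P (x t))) \<longlongrightarrow> 0) at_top"
    using has_vector_derivative_energy[OF x] f''
    by (intro tendsto_zero_derivative_of_convergent[OF lim])
  from tendsto_mult_left[OF this, of "1/2"] show ?thesis by simp
qed

text \<open>Stability follows from the uniform solution bound with
  \<open>\<delta> = \<epsilon> / C\<close>, so only attractivity is left to prove.\<close>

lemma origin_GAS_onI:
  assumes "\<And>x. solves_ode A x \<Longrightarrow> x 0 \<in> \<Omega> \<Longrightarrow> (x \<longlongrightarrow> 0) at_top"
  shows "origin_GAS_on \<Omega> A"
  unfolding origin_GAS_on_def
proof (intro conjI allI impI)
  obtain C where C: "C > 0" "\<And>x t. solves_ode A x \<Longrightarrow> t \<ge> 0 \<Longrightarrow> norm (x t) \<le> C * norm (x 0)"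
    using solution_bound by blast
  fix \<epsilon> :: real assume "\<epsilon> > 0"
  show "\<exists>\<delta>>0. \<forall>x. solves_ode A x \<and> x 0 \<in> \<Omega> \<and> norm (x 0) < \<delta> \<longrightarrow> (\<forall>t\<ge>0. norm (x t) < \<epsilon>)"
  proof (intro exI[of _ "\<epsilon> / C"] conjI allI impI)
    fix x t assume x: "solves_ode A x \<and> x 0 \<in> \<Omega> \<and> norm (x 0) < \<epsilon> / C" and "(t::real) \<ge> 0"
    then have "norm (x t) \<le> C * norm (x 0)" using C(2) by blast
    also have "\<dots> < \<epsilon>" using x C(1) by (simp add: field_simps)
    finally show "norm (x t) < \<epsilon>" .
  qed (use \<open>\<epsilon> > 0\<close> C(1) in simp)
qed (use assms in blast)

end

section \<open>Injective linear maps and positive definite matrices\<close>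

text \<open>In finite dimension an injective linear map on a subspace is bounded below there, so
  \<open>norm (f (g t))\<close> controls \<open>norm (g t)\<close>.\<close>

lemma tendsto_zero_of_injective_on:
  fixes f :: "'a::euclidean_space \<Rightarrow> 'b::euclidean_space"
  assumes "subspace S" "linear f" "\<And>x. x \<in> S \<Longrightarrow> f x = 0 \<Longrightarrow> x = 0"
    and "\<forall>\<^sub>F t in F. g t \<in> S" "((\<lambda>t. f (g t)) \<longlongrightarrow> 0) F"
  shows "(g \<longlongrightarrow> 0) F"
proof -
  have "bounded_linear f" using assms(2) by (simp add: linear_conv_bounded_linear)
  then have "\<exists>e>0. \<forall>x\<in>S. e * norm x \<le> norm (f x)"
    using assms(3) by (intro injective_imp_isometric closed_subspace assms(1)) blast+
  then obtain e where e: "e > 0" "\<forall>x\<in>S. e * norm x \<le> norm (f x)"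
    by blast
  have "((\<lambda>t. norm (f (g t)) / e) \<longlongrightarrow> 0) F"
    using tendsto_divide[OF tendsto_norm[OF assms(5)] tendsto_const[of e]] e(1) by simp
  moreover have "\<forall>\<^sub>F t in F. norm (g t) \<le> norm (f (g t)) / e"
    using assms(4)
  proof eventually_elim
    case (elim t)
    then have "e * norm (g t) \<le> norm (f (g t))" using e(2) by blast
    then show ?case by (simp add: pos_le_divide_eq[OF e(1)] mult.commute[of e])
  qed
  ultimately show ?thesis by (rule Lim_null_comparison[rotated])
qed

lemma pos_definite_imp_pos_semidefinite: "pos_definite A \<Longrightarrow> pos_semidefinite A"
  unfolding pos_definite_def pos_semidefinite_def
  by (metis inner_zero_left less_eq_real_def)

lemma inner_symmetric_matrix:
  fixes A :: "real^'n^'n"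
  assumes "transpose A = A"
  shows "(A *v x) \<bullet> y = x \<bullet> (A *v y)"
  by (metis assms dot_lmul_matrix transpose_matrix_vector)

lemma pos_definite_mult_eq_0: "pos_definite A \<Longrightarrow> A *v x = 0 \<Longrightarrow> x = 0"
  unfolding pos_definite_def by force

lemma pos_definite_invertible: "pos_definite A \<Longrightarrow> invertible A"
  unfolding invertible_left_inverse matrix_left_invertible_ker
  using pos_definite_mult_eq_0 by blast

lemma matrix_inv_right:
  assumes "invertible A"
  shows "A ** matrix_inv A = mat 1"
  using someI_ex[OF assms[unfolded invertible_def]] unfolding matrix_inv_def by blast

text \<open>Writing each vector as \<open>A\<close> applied to its image under the inverse transfers
  symmetry and positivity from \<open>A\<close>.\<close>

lemma pos_definite_matrix_inv:
  assumes A: "pos_definite A"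
  shows "pos_definite (matrix_inv A)"
proof -
  let ?N = "matrix_inv A"
  have inv: "A *v (?N *v x) = x" for x
    using matrix_inv_right[OF pos_definite_invertible[OF A]]
    by (simp add: matrix_vector_mul_assoc)
  have sym: "transpose A = A" using A by (simp add: pos_definite_def)
  have "(?N *v x) \<bullet> y = x \<bullet> (?N *v y)" for x y
    using inner_symmetric_matrix[OF sym, of "?N *v x" "?N *v y"] by (simp add: inv)
  then have "transpose ?N *v x = ?N *v x" for x
    by (metis dot_lmul_matrix transpose_matrix_vector vector_eq_rdot)
  then have "transpose ?N = ?N" by (simp add: matrix_eq)
  moreover have "0 < x \<bullet> (?N *v x)" if "x \<noteq> 0" for x
  proof -
    have "?N *v x \<noteq> 0" using inv[of x] that by auto
    then have "0 < (?N *v x) \<bullet> (A *v (?N *v x))" using A by (simp add: pos_definite_def)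
    then show ?thesis by (simp add: inv inner_commute)
  qed
  ultimately show ?thesis by (simp add: pos_definite_def)
qed

section \<open>The system as a damped oscillator\<close>

text \<open>The system with the block and graph structure forgotten: mass \<open>M\<close>, damping
  \<open>R\<close>, stiffness \<open>W\<close>, coupling \<open>B\<close>.\<close>

locale damped_oscillator =
  fixes M R :: "real^'n^'n" and W :: "real^'m^'m" and B :: "real^'m^'n"
  assumes M: "pos_definite M" and W: "pos_definite W" and R: "pos_semidefinite R"
begin

definition velocity :: "(real^'n) \<times> (real^'m) \<Rightarrow> real^'n" where
  "velocity x = matrix_inv M *v fst x"

definition field :: "(real^'n) \<times> (real^'m) \<Rightarrow> (real^'n) \<times> (real^'m)" where
  "field x = (- (R *v velocity x) - B *v (W *v snd x), transpose B *v velocity x)"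

text \<open>The gradient of the energy from the overview; it takes the role of \<open>P\<close> in
  \<open>dissipative_system\<close>.\<close>

definition co_energy :: "(real^'n) \<times> (real^'m) \<Rightarrow> (real^'n) \<times> (real^'m)" where
  "co_energy x = (velocity x, W *v snd x)"

lemma mass_velocity: "M *v velocity x = fst x"
  using matrix_inv_right[OF pos_definite_invertible[OF M]]
  by (simp add: velocity_def matrix_vector_mul_assoc)

lemma bounded_linear_velocity: "bounded_linear velocity"
  unfolding velocity_def
  by (intro bounded_linear_compose[OF matrix_vector_mul_bounded_linear] bounded_linear_fst)

lemma bounded_linear_field: "bounded_linear field"
  unfolding field_def
  by (intro bounded_linear_Pair bounded_linear_sub bounded_linear_minus bounded_linear_snd
        bounded_linear_compose[OF matrix_vector_mul_bounded_linear] bounded_linear_velocity)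

lemma bounded_linear_co_energy: "bounded_linear co_energy"
  unfolding co_energy_def
  by (intro bounded_linear_Pair bounded_linear_snd
        bounded_linear_compose[OF matrix_vector_mul_bounded_linear] bounded_linear_velocity)

text \<open>The coupling is skew: the power that \<open>B\<close> takes from the momenta is what its
  transpose gives to \<open>q\<close>, so the two terms cancel and only damping remains.\<close>

lemma field_inner_co_energy: "field x \<bullet> co_energy x = - (velocity x \<bullet> (R *v velocity x))"
proof -
  have "(B *v (W *v snd x)) \<bullet> velocity x = (transpose B *v velocity x) \<bullet> (W *v snd x)"
    by (metis dot_lmul_matrix inner_commute transpose_matrix_vector)
  then show ?thesis
    by (simp add: field_def co_energy_def inner_diff_left inner_commute[of "R *v velocity x"]
          del: transpose_matrix_vector)
qed

sublocale dissipative_system field co_energy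
proof (rule dissipative_system.intro)
  show "linear field" "linear co_energy"
    using bounded_linear_field bounded_linear_co_energy by (simp_all add: linear_conv_bounded_linear)
  have N: "pos_definite (matrix_inv M)" by (rule pos_definite_matrix_inv[OF M])
  show "co_energy x \<bullet> y = x \<bullet> co_energy y" for x y
    using inner_symmetric_matrix[of "matrix_inv M"] inner_symmetric_matrix[of W] N W
    by (simp add: co_energy_def velocity_def inner_prod_def pos_definite_def)
  show "0 < x \<bullet> co_energy x" if "x \<noteq> 0" for x
  proof -
    have "0 \<le> fst x \<bullet> velocity x" "0 \<le> snd x \<bullet> (W *v snd x)"
      using pos_definite_imp_pos_semidefinite N W by (auto simp: velocity_def pos_semidefinite_def)
    moreover have "0 < fst x \<bullet> velocity x \<or> 0 < snd x \<bullet> (W *v snd x)"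
      using that N W by (auto simp: velocity_def pos_definite_def prod_eq_iff)
    ultimately show ?thesis by (auto simp: co_energy_def inner_prod_def)
  qed
  show "field x \<bullet> co_energy x \<le> 0" for x
    using R by (simp add: field_inner_co_energy pos_semidefinite_def)
qed

lemma subspace_range_transpose: "subspace (range (\<lambda>z. transpose B *v z))"
  by (intro linear_subspace_image[OF _ subspace_UNIV] matrix_vector_mul_linear)

text \<open>The derivative of \<open>q\<close> lies in the image of the transpose of
  \<open>B\<close>, so every component of \<open>q\<close> orthogonal to that image is conserved,
  here at the value 0. The double orthogonal complement then returns the image itself.\<close>

lemma range_transpose_invariant:
  assumes x: "solves_ode field x" and x0: "snd (x 0) \<in> range (\<lambda>z. transpose B *v z)" and t: "t \<ge> 0"
  shows "snd (x t) \<in> range (\<lambda>z. transpose B *v z)" (is "_ \<in> ?S")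
proof -
  have "w \<bullet> snd (x t) = 0" if w: "w \<in> ?S\<^sup>\<bottom>" for w
  proof -
    have perp: "w \<bullet> s = 0" if "s \<in> ?S" for s
      using w that by (auto simp: orthogonal_comp_def orthogonal_def inner_commute)
    have bl: "bounded_linear (\<lambda>z. w \<bullet> snd z)"
      by (intro bounded_linear_compose[OF bounded_linear_inner_right] bounded_linear_snd)
    have der: "((\<lambda>t. w \<bullet> snd (x t)) has_vector_derivative 0) (at s within {0..})"
      if "s \<in> {0..}" for s
      using has_vector_derivative_linear_along[OF x bl, of s] that
      by (simp add: field_def perp del: transpose_matrix_vector)
    obtain c where "\<And>s. s \<in> {0..} \<Longrightarrow> w \<bullet> snd (x s) = c"
      by (rule has_vector_derivative_zero_constant[OF convex_real_interval(1) der]) (assumption, rule that, simp)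
    then have "w \<bullet> snd (x t) = w \<bullet> snd (x 0)" using t by simp
    then show ?thesis using perp[OF x0] by simp
  qed
  then have "snd (x t) \<in> ?S\<^sup>\<bottom>\<^sup>\<bottom>" by (simp add: orthogonal_comp_def orthogonal_def)
  then show ?thesis using orthogonal_comp_self[OF subspace_range_transpose] by simp
qed

lemma tendsto_zero_if_velocity_tendsto_zero:
  assumes x: "solves_ode field x" and x0: "snd (x 0) \<in> range (\<lambda>z. transpose B *v z)"
    and v: "((\<lambda>t. velocity (x t)) \<longlongrightarrow> 0) at_top"
  shows "(x \<longlongrightarrow> 0) at_top"
proof -
  have mat: "((\<lambda>t. C *v velocity (x t)) \<longlongrightarrow> 0) at_top" for C :: "real^'n^'k"
    using bounded_linear.tendsto[OF matrix_vector_mul_bounded_linear v, of C] by simp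
  have p: "((\<lambda>t. fst (x t)) \<longlongrightarrow> 0) at_top" using mat[of M] by (simp add: mass_velocity)
  \<comment> \<open>Since the momentum converges, its derivative tends to 0; removing the vanishing
    damping term from it isolates \<open>B W q\<close>.\<close>
  have "((\<lambda>t. fst (field (x t))) \<longlongrightarrow> 0) at_top"
    by (rule tendsto_zero_linear_derivative[OF x bounded_linear_fst p])
  from tendsto_minus[OF tendsto_add[OF this mat[of R]]]
  have BWq: "((\<lambda>t. B *v (W *v snd (x t))) \<longlongrightarrow> 0) at_top" by (simp add: field_def)
  have "((\<lambda>t. snd (x t)) \<longlongrightarrow> 0) at_top"
  proof (rule tendsto_zero_of_injective_on[where f = "\<lambda>q. B *v (W *v q)",
        OF subspace_range_transpose _ _ _ BWq])
    show "linear (\<lambda>q. B *v (W *v q))"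
      by (simp add: matrix_vector_mul_assoc)
    fix q assume "q \<in> range (\<lambda>z. transpose B *v z)" and q0: "B *v (W *v q) = 0"
    then obtain z where "q = transpose B *v z" by blast
    \<comment> \<open>Moving the transpose of \<open>B\<close> across the inner product turns
      \<open>B W q = 0\<close> into a vanishing \<open>W\<close>-form at \<open>q\<close>, so
      definiteness of \<open>W\<close> gives the injectivity.\<close>
    then have "q \<bullet> (W *v q) = z \<bullet> (B *v (W *v q))" by (simp add: dot_lmul_matrix)
    then have "q \<bullet> (W *v q) = 0" using q0 by simp
    then show "q = 0" using W unfolding pos_definite_def by (metis less_irrefl)
  next
    show "\<forall>\<^sub>F t in at_top. snd (x t) \<in> range (\<lambda>z. transpose B *v z)"
      using eventually_ge_at_top[of 0] by eventually_elim (rule range_transpose_invariant[OF x x0])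
  qed
  from tendsto_Pair[OF p this] show ?thesis by (simp add: zero_prod_def)
qed

end

section \<open>Block structure of vectors and matrices\<close>

text \<open>The part of a stacked vector that belongs to one node or edge. With it, block diagonal
  and Kronecker matrices can be handled blockwise instead of entrywise.\<close>

definition block :: "real^('i \<times> 'r) \<Rightarrow> 'i::finite \<Rightarrow> real^'r::finite" where
  "block x i = (\<chi> a. x $ (i, a))"

lemma block_eqI: "(\<And>i. block x i = block y i) \<Longrightarrow> x = y"
  by (auto simp: vec_eq_iff block_def)

lemma linear_block: "linear (\<lambda>x. block x i)"
  by (rule linearI) (auto simp: block_def vec_eq_iff)

lemma bounded_linear_block: "bounded_linear (\<lambda>x. block x i)"
  using linear_block by (simp add: linear_conv_bounded_linear)

lemma block_zero [simp]: "block 0 i = 0"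
  by (rule linear_0[OF linear_block])

lemma inner_block: "x \<bullet> y = (\<Sum>i\<in>UNIV. block x i \<bullet> block y i)"
  by (simp add: inner_vec_def block_def sum.cartesian_product flip: UNIV_Times_UNIV)

lemma sum_prod_UNIV: "(\<Sum>z\<in>UNIV. g z) = (\<Sum>i\<in>UNIV. \<Sum>a\<in>UNIV. g (i, a))"
  by (simp add: sum.cartesian_product flip: UNIV_Times_UNIV)

lemma block_block_diag: "block (block_diag A *v x) i = A i *v block x i"
proof -
  have "(\<Sum>z\<in>UNIV. (if i = fst z then A i $ a $ snd z else 0) * x $ z)
      = (\<Sum>b\<in>UNIV. A i $ a $ b * x $ (i, b))" for a
    unfolding sum_prod_UNIV
    by (subst sum.remove[of _ i]) (auto intro!: sum.neutral)
  then show ?thesis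
    by (simp add: vec_eq_iff block_def block_diag_def matrix_vector_mult_def cong: if_cong)
qed

lemma block_kronecker_id: "block (kronecker_id B *v x) i = (\<Sum>e\<in>UNIV. B $ i $ e *\<^sub>R block x e)"
proof -
  have "(\<Sum>z\<in>UNIV. B $ i $ fst z * mat 1 $ a $ snd z * x $ z)
      = (\<Sum>e\<in>UNIV. B $ i $ e * x $ (e, a))" for a
    unfolding sum_prod_UNIV
    by (intro sum.cong refl, subst sum.remove[of _ a]) (auto simp: mat_def intro!: sum.neutral)
  then show ?thesis
    by (simp add: vec_eq_iff block_def kronecker_id_def matrix_vector_mult_def)
qed

lemma transpose_kronecker_id: "transpose (kronecker_id B) = kronecker_id (transpose B)"
  by (auto simp: vec_eq_iff transpose_def kronecker_id_def mat_def)

lemma block_transpose_kronecker_id: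
  "block (transpose (kronecker_id B) *v x) e = (\<Sum>i\<in>UNIV. B $ i $ e *\<^sub>R block x i)"
  unfolding transpose_kronecker_id block_kronecker_id by (simp add: transpose_def)

lemma transpose_block_diag: "transpose (block_diag A) = block_diag (\<lambda>i. transpose (A i))"
  by (auto simp: vec_eq_iff transpose_def block_diag_def)

lemma inner_block_diag: "x \<bullet> (block_diag A *v x) = (\<Sum>i\<in>UNIV. block x i \<bullet> (A i *v block x i))"
  by (simp add: inner_block block_block_diag)

lemma pos_semidefinite_block_diag:
  assumes "\<And>i. pos_semidefinite (A i)"
  shows "pos_semidefinite (block_diag A)"
  using assms
  by (auto simp: pos_semidefinite_def transpose_block_diag inner_block_diag intro!: sum_nonneg)

lemma pos_definite_block_diag:
  assumes A: "\<And>i. pos_definite (A i)"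
  shows "pos_definite (block_diag A)"
  unfolding pos_definite_def
proof (intro conjI allI impI)
  show "transpose (block_diag A) = block_diag A"
    using A by (simp add: transpose_block_diag pos_definite_def)
  fix x :: "real^('a \<times> 'b)" assume "x \<noteq> 0"
  then obtain i where "block x i \<noteq> 0" using block_eqI[of x 0] by auto
  then have "0 < block x i \<bullet> (A i *v block x i)" using A by (simp add: pos_definite_def)
  then show "0 < x \<bullet> (block_diag A *v x)"
    unfolding inner_block_diag
    using A pos_definite_imp_pos_semidefinite
    by (intro sum_pos2[of _ i]) (auto simp: pos_semidefinite_def)
qed

text \<open>The block \<open>W e\<close> enters row \<open>i\<close> of the product only with the
  factor \<open>B $ i $ e\<close>. This permits changing the weights at sets that are not
  edges.\<close>

lemma kronecker_id_block_diag_cong: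
  assumes "\<And>i e. B $ i $ e \<noteq> 0 \<Longrightarrow> W e = W' e"
  shows "kronecker_id B ** block_diag W = kronecker_id B ** block_diag W'"
proof -
  have "(kronecker_id B ** block_diag W) *v x = (kronecker_id B ** block_diag W') *v x" for x
  proof (rule block_eqI)
    fix i
    have eq: "B $ i $ e *\<^sub>R (W e *v block x e) = B $ i $ e *\<^sub>R (W' e *v block x e)" for e
      using assms[of i e] by (cases "B $ i $ e = 0") auto
    then show "block ((kronecker_id B ** block_diag W) *v x) i
        = block ((kronecker_id B ** block_diag W') *v x) i"
      by (simp only: block_kronecker_id block_block_diag eq flip: matrix_vector_mul_assoc)
  qed
  then show ?thesis by (simp add: matrix_eq)
qed

section \<open>Incidence matrices and the forcing process\<close>

text \<open>The orientation sign of the edge occurs twice, once in the outer factor and once in the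
  sum, so it cancels: the result is the difference seen from \<open>u\<close> whichever way the edge
  points.\<close>

lemma incidence_difference:
  fixes y :: "'v::finite \<Rightarrow> 'a::real_vector"
  assumes B: "oriented_incidence_matrix E B" and e: "{u, v} \<in> E" and "u \<noteq> v"
  shows "B $ u $ {u, v} *\<^sub>R (\<Sum>i\<in>UNIV. B $ i $ {u, v} *\<^sub>R y i) = y u - y v"
proof -
  obtain a b where ab: "a \<noteq> b" "{u, v} = {a, b}" "B $ a $ {u, v} = 1" "B $ b $ {u, v} = -1"
    "\<And>w. w \<notin> {u, v} \<Longrightarrow> B $ w $ {u, v} = 0"
    using B e unfolding oriented_incidence_matrix_def by metis
  have "(\<Sum>i\<in>UNIV. B $ i $ {u, v} *\<^sub>R y i) = (\<Sum>i\<in>{u, v}. B $ i $ {u, v} *\<^sub>R y i)"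
    by (intro sum.mono_neutral_right) (auto simp: ab(5))
  also have "\<dots> = B $ u $ {u, v} *\<^sub>R y u + B $ v $ {u, v} *\<^sub>R y v"
    using \<open>u \<noteq> v\<close> by simp
  finally have sum: "(\<Sum>i\<in>UNIV. B $ i $ {u, v} *\<^sub>R y i) = \<dots>" .
  have "u = a \<and> v = b \<or> u = b \<and> v = a"
    using ab(2) by (auto simp: doubleton_eq_iff)
  then have "B $ u $ {u, v} = 1 \<and> B $ v $ {u, v} = -1 \<or> B $ u $ {u, v} = -1 \<and> B $ v $ {u, v} = 1"
    using ab(3,4) by auto
  then show ?thesis unfolding sum by (auto simp: algebra_simps)
qed

lemma incidence_eq_0:
  assumes "oriented_incidence_matrix E B" "u \<notin> e \<or> e \<notin> E"
  shows "B $ u $ e = 0"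
  using assms unfolding oriented_incidence_matrix_def by metis

lemma zero_forcing_property_reach:
  assumes "zero_forcing_property Vd E"
  shows "(force_step E)\<^sup>*\<^sup>* Vd UNIV"
proof -
  have "terminal_black_set Vd E (final_black_set Vd E)"
    unfolding final_black_set_def by (rule theI'[OF ex1_terminal_black_set])
  then show ?thesis
    using assms by (simp add: terminal_black_set_def zero_forcing_property_def)
qed

section \<open>Propagation of vanishing velocities along zero forcing\<close>

theorem corollary5p11:
  fixes Vd :: "'v::finite set" and E :: "'v set set"
  assumes "damping_graph Vd E"
    and "zero_forcing_property Vd E"
  shows "PI_GAS TYPE('r::finite) Vd E"
  unfolding PI_GAS_def
proof (intro allI impI)
  fix B :: "real^('v set)^'v" and M :: "'v \<Rightarrow> real^'r^'r" and W0 :: "'v set \<Rightarrow> real^'r^'r"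
    and R :: "'v \<Rightarrow> real^'r^'r"
  assume B: "oriented_incidence_matrix E B" and feas: "feasible Vd E M W0 R"
  \<comment> \<open>The blocks outside \<open>E\<close> are arbitrary; replacing them by the identity changes nothing and
    makes the quadratic form of the energy positive definite on the whole space.\<close>
  define W where "W e = (if e \<in> E then W0 e else mat 1)" for e
  have M_pos: "pos_definite (M i)" for i using feas by (simp add: feasible_def)
  have Rd: "pos_definite (R i)" if "i \<in> Vd" for i using feas that by (simp add: feasible_def)
  have R_psd: "pos_semidefinite (R i)" for i
    using feas Rd pos_definite_imp_pos_semidefinite by (cases "i \<in> Vd") (auto simp: feasible_def)
  have "pos_definite (mat 1 :: real^'r^'r)" by (simp add: pos_definite_def)
  then have W_pos: "pos_definite (W e)" for e using feas by (simp add: feasible_def W_def)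
  interpret damped_oscillator "block_diag M" "block_diag R" "block_diag W" "kronecker_id B"
    by unfold_locales
       (use M_pos W_pos R_psd in \<open>auto intro: pos_definite_block_diag pos_semidefinite_block_diag\<close>)
  have "kronecker_id B ** block_diag W0 = kronecker_id B ** block_diag W"
    using incidence_eq_0[OF B] by (intro kronecker_id_block_diag_cong) (auto simp: W_def)
  then have field: "system_field B M W0 R = field"
    by (simp add: fun_eq_iff system_field_def field_def velocity_def matrix_vector_mul_assoc
        del: transpose_matrix_vector)
  show "origin_GAS_on (state_subspace B) (system_field B M W0 R)"
    unfolding field
  proof (rule origin_GAS_onI)
    fix x assume x: "solves_ode field x" and "x 0 \<in> state_subspace B"
    then have x0: "snd (x 0) \<in> range (\<lambda>z. transpose (kronecker_id B) *v z)"
      by (auto simp: state_subspace_def)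
    let ?y = "\<lambda>i t. block (velocity (x t)) i"
    have damped: "(?y i \<longlongrightarrow> 0) at_top" if i: "i \<in> Vd" for i
    proof -
      obtain c where c: "c > 0" "\<And>z. c * (norm z)\<^sup>2 \<le> z \<bullet> (R i *v z)"
        using positive_quadratic_form_lower_bound[of "(*v) (R i)"] Rd[OF i]
        by (auto simp: pos_definite_def)
      have "((\<lambda>t. velocity (x t) \<bullet> (block_diag R *v velocity (x t))) \<longlongrightarrow> 0) at_top"
        using tendsto_minus[OF tendsto_zero_dissipation[OF x]] by (simp add: field_inner_co_energy)
      then have lim: "((\<lambda>t. (velocity (x t) \<bullet> (block_diag R *v velocity (x t))) / c) \<longlongrightarrow> 0) at_top"
        by (rule tendsto_divide_zero)
      have "(norm (?y i t))\<^sup>2 \<le> (velocity (x t) \<bullet> (block_diag R *v velocity (x t))) / c" for t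
      proof -
        have "c * (norm (?y i t))\<^sup>2 \<le> ?y i t \<bullet> (R i *v ?y i t)" by (rule c)
        \<comment> \<open>The total dissipation is a sum of nonnegative node contributions, so it
          dominates the one of node \<open>i\<close>.\<close>
        also have "\<dots> \<le> velocity (x t) \<bullet> (block_diag R *v velocity (x t))"
          unfolding inner_block_diag using R_psd
          by (intro member_le_sum) (auto simp: pos_semidefinite_def)
        finally show ?thesis by (simp add: pos_le_divide_eq[OF c(1)] mult.commute[of c])
      qed
      then have "((\<lambda>t. (norm (?y i t))\<^sup>2) \<longlongrightarrow> 0) at_top"
        by (intro Lim_null_comparison[OF _ lim] always_eventually allI) simp
      from tendsto_real_sqrt[OF this] show ?thesis by (simp add: tendsto_norm_zero_iff)
    qed
    have forced: "(?y w \<longlongrightarrow> 0) at_top"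
      if S: "\<And>i. i \<in> S \<Longrightarrow> (?y i \<longlongrightarrow> 0) at_top" and u: "u \<in> S"
        and w: "{v. {u, v} \<in> E \<and> v \<notin> S} = {w}" for S u w
    proof -
      \<comment> \<open>The contribution of the edge \<open>e\<close> to the
        \<open>u\<close>-component of \<open>B W B^T y\<close>, with the outer incidence coefficient
        moved inside \<open>W e\<close>.\<close>
      let ?f = "\<lambda>e t. W e *v (B $ u $ e *\<^sub>R (\<Sum>i\<in>UNIV. B $ i $ e *\<^sub>R ?y i t))"
      have edge: "?f {u, v} t = W {u, v} *v (?y u t - ?y v t)" if "{u, v} \<in> E" "u \<noteq> v" for v t
        using incidence_difference[OF B that, of "\<lambda>i. ?y i t"] by simp
      have w_white: "w \<in> {v. {u, v} \<in> E \<and> v \<notin> S}" unfolding w by simp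
      have uw: "{u, w} \<in> E" "w \<notin> S" "u \<noteq> w" using u w_white by auto
      note mat = bounded_linear.tendsto[OF matrix_vector_mul_bounded_linear, where g = "?y u", OF S[OF u]]
      have "((\<lambda>t. block (fst (x t)) u) \<longlongrightarrow> 0) at_top"
        using mat[of "M u"] by (simp add: block_block_diag flip: mass_velocity)
      then have "((\<lambda>t. block (fst (field (x t))) u) \<longlongrightarrow> 0) at_top"
        by (intro tendsto_zero_linear_derivative[OF x, where L = "\<lambda>z. block (fst z) u"]
            bounded_linear_compose[OF bounded_linear_block] bounded_linear_fst)
      \<comment> \<open>The damping force at \<open>u\<close> depends on the velocity of
        \<open>u\<close> alone and so vanishes too, leaving the spring force.\<close>
      from tendsto_minus[OF tendsto_add[OF this mat[of "R u"]]]
      have force: "((\<lambda>t. block (kronecker_id B *v (block_diag W *v snd (x t))) u) \<longlongrightarrow> 0) at_top"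
        by (simp add: field_def linear_diff[OF linear_block] linear_neg[OF linear_block]
            block_block_diag)
      have "((\<lambda>t. block (kronecker_id B *v (block_diag W *v snd (field (x t)))) u) \<longlongrightarrow> 0) at_top"
        by (intro tendsto_zero_linear_derivative[OF x _ force] bounded_linear_compose[OF bounded_linear_block]
            bounded_linear_compose[OF matrix_vector_mul_bounded_linear] bounded_linear_snd)
      moreover have "block (kronecker_id B *v (block_diag W *v snd (field (x t)))) u = (\<Sum>e\<in>UNIV. ?f e t)" for t
        by (simp add: field_def block_kronecker_id block_block_diag block_transpose_kronecker_id
            matrix_vector_mult_scaleR del: transpose_matrix_vector)
      ultimately have total: "((\<lambda>t. \<Sum>e\<in>UNIV. ?f e t) \<longlongrightarrow> 0) at_top" by simp
      \<comment> \<open>The index \<open>e\<close> ranges over all sets of nodes. Either it is an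
        edge from \<open>u\<close> to some \<open>v\<close> other than \<open>w\<close>, and then
        \<open>v\<close> is in \<open>S\<close> because \<open>w\<close> is the only white neighbor;
        or the incidence coefficient at \<open>u\<close> is 0.\<close>
      have "(?f e \<longlongrightarrow> 0) at_top" if "e \<in> UNIV - {{u, w}}" for e
      proof (cases "u \<in> e \<and> e \<in> E")
        case True
        then have "card e = 2" using assms(1) by (simp add: damping_graph_def)
        then obtain a b where "e = {a, b}" "a \<noteq> b" by (auto simp: card_2_iff)
        then obtain v where v: "e = {u, v}" "u \<noteq> v"
          using True by (metis insertE insert_commute singletonD)
        have "v \<in> S"
        proof (rule ccontr)
          assume "v \<notin> S"
          then have "v \<in> {v. {u, v} \<in> E \<and> v \<notin> S}" using True v(1) by simp
          then have "v = w" unfolding w by simp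
          then show False using that v(1) by simp
        qed
        then have "((\<lambda>t. W e *v (?y u t - ?y v t)) \<longlongrightarrow> W e *v (0 - 0)) at_top"
          by (intro bounded_linear.tendsto[OF matrix_vector_mul_bounded_linear] tendsto_diff S u)
        then show ?thesis using True v edge[of v] by simp
      next
        case False
        then have "B $ u $ e = 0" using incidence_eq_0[OF B] by blast
        then show ?thesis by simp
      qed
      then have "((\<lambda>t. \<Sum>e\<in>UNIV - {{u, w}}. ?f e t) \<longlongrightarrow> 0) at_top"
        by (intro tendsto_null_sum)
      from tendsto_diff[OF total this]
      have "((\<lambda>t. (\<Sum>e\<in>UNIV. ?f e t) - (\<Sum>e\<in>UNIV - {{u, w}}. ?f e t)) \<longlongrightarrow> 0) at_top" by simp
      moreover have "(\<Sum>e\<in>UNIV. ?f e t) - (\<Sum>e\<in>UNIV - {{u, w}}. ?f e t) = ?f {u, w} t" for t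
        by (subst sum.remove[of UNIV "{u, w}"]) simp_all
      ultimately have "(?f {u, w} \<longlongrightarrow> 0) at_top" by simp
      then have "((\<lambda>t. W {u, w} *v (?y u t - ?y w t)) \<longlongrightarrow> 0) at_top"
        using edge[OF uw(1,3)] by simp
      \<comment> \<open>The stiffness of this one edge is positive definite, hence injective, and
        can be stripped off.\<close>
      then have "((\<lambda>t. ?y u t - ?y w t) \<longlongrightarrow> 0) at_top"
        by (rule tendsto_zero_of_injective_on[where f = "(*v) (W {u, w})", OF subspace_UNIV
              matrix_vector_mul_linear pos_definite_mult_eq_0[OF W_pos] always_eventually, rotated 2]) simp_all
      from tendsto_diff[OF S[OF u] this] show ?thesis by simp
    qed
    \<comment> \<open>Induction along the recolorings: all nodes black so far have asymptotically
      vanishing velocity.\<close>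
    have "\<forall>i\<in>S. (?y i \<longlongrightarrow> 0) at_top" if "(force_step E)\<^sup>*\<^sup>* Vd S" for S
      using that
    proof (induction rule: rtranclp_induct)
      case base
      then show ?case using damped by blast
    next
      case (step S S')
      then obtain u w where "u \<in> S" "{v. {u, v} \<in> E \<and> v \<notin> S} = {w}" "S' = insert w S"
        unfolding force_step_def by blast
      then show ?case using forced[of S u w] step.IH by blast
    qed
    then have y: "(?y i \<longlongrightarrow> 0) at_top" for i
      using zero_forcing_property_reach[OF assms(2)] by blast
    have "((\<lambda>t. velocity (x t)) \<longlongrightarrow> 0) at_top"
    proof (rule vec_tendstoI)
      fix z :: "'v \<times> 'r"
      have "((\<lambda>t. ?y (fst z) t $ snd z) \<longlongrightarrow> 0 $ snd z) at_top"
        by (rule tendsto_vec_nth[OF y])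
      then show "((\<lambda>t. velocity (x t) $ z) \<longlongrightarrow> 0 $ z) at_top" by (simp add: block_def)
    qed
    then show "(x \<longlongrightarrow> 0) at_top" by (rule tendsto_zero_if_velocity_tendsto_zero[OF x x0])
  qed
qed

end
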